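(* Let $\lambda$ be a nonzero real number, let $r\ge0$ be an integer, and let $n,m\ge 0$ be integers. Then \[ \phi^{(r)}_{n+m,\lambda}(x)=\sum_{k=0}^{m}\sum_{l=0}^{n}\binom{n}{l}{m+r \brace k+r}_{r,\lambda}(k-m\lambda)_{n-l,\lambda}\,x^{k}\,\phi^{(r)}_{l,\lambda}(x). \] In particular, setting $x=1$, \[ \phi^{(r)}_{n+m,\lambda}=\sum_{k=0}^{m}\sum_{l=0}^{n}\binom{n}{l}{m+r \brace k+r}_{r,\lambda}(k-m\lambda)_{n-l,\lambda}\,\phi^{(r)}_{l,\lambda}, \] where $\phi^{(r)}_{n,\lambda}=\phi^{(r)}_{n,\lambda}(1)$.
   Context: For nonzero real $\lambda$, the degenerate falling factorial is $(x)_{0,\lambda}=1$, $(x)_{n,\lambda}=x(x-\lambda)(x-2\lambda)\cdots(x-(n-1)\lambda)$ for $n\ge1$. The degenerate exponentials are the formal power series $e_\lambda^{x}(t)=\sum_{n\ge0}(x)_{n,\lambda}\frac{t^n}{n!}$ and $e_\lambda(t)=e_\lambda^{1}(t)$. For a nonnegative integer $r$, the degenerate $r$-Stirling numbers of the second kind ${n+r\brace k+r}_{r,\lambda}$ are defined by $(x+r)_{n,\lambda}=\sum_{k=0}^n {n+r\brace k+r}_{r,\lambda}(x)_k$, with $(x)_k=x(x-1)\cdots(x-k+1)$, $(x)_0=1$. The degenerate $r$-Bell polynomials are defined by $e^{x(e_\lambda(t)-1)}e_\lambda^{r}(t)=\sum_{n\ge0}\phi^{(r)}_{n,\lambda}(x)\frac{t^n}{n!}$;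 equivalently $\phi^{(r)}_{n,\lambda}(x)=\sum_{k=0}^n {n+r\brace k+r}_{r,\lambda}x^k$. *)

theory Defs
  imports Complex_Main "HOL-Computational_Algebra.Computational_Algebra"
begin

text \<open>Degenerate falling factorial; for \<open>lam = 1\<close> it is the ordinary falling factorial \<open>(x)\<^sub>n\<close>.\<close>

definition deg_ffact :: "real \<Rightarrow> real \<Rightarrow> nat \<Rightarrow> real" where
  "deg_ffact lam x n = (\<Prod>i<n. x - real i * lam)"

abbreviation ffact :: "real \<Rightarrow> nat \<Rightarrow> real" where
  "ffact x n \<equiv> deg_ffact 1 x n"

definition deg_exp :: "real \<Rightarrow> real \<Rightarrow> real fps" where
  "deg_exp lam x = Abs_fps (\<lambda>n. deg_ffact lam x n / fact n)"

text \<open>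
  Row \<open>n\<close> of the degenerate \<open>r\<close>-Stirling numbers of the second kind: the coefficients of
  \<open>deg_ffact lam (x + r) n\<close> in the basis of ordinary falling factorials, extended by \<open>0\<close> for
  \<open>k > n\<close>.
  The number with upper entry \<open>n + r\<close> and lower entry \<open>k + r\<close> is \<open>deg_rStirling lam r n k\<close>.
\<close>

definition deg_rStirling :: "real \<Rightarrow> nat \<Rightarrow> nat \<Rightarrow> nat \<Rightarrow> real" where
  "deg_rStirling lam r n = (THE c. (\<forall>k>n. c k = 0) \<and>
     (\<forall>x. deg_ffact lam (x + real r) n = (\<Sum>k\<le>n. c k * ffact x k)))"

text \<open>
  The generating function is read in \<open>\<real>[x][[t]]\<close>: \<open>exp_x\<close> is the series of \<open>exp (x t)\<close>, and
  \<open>fps_const_poly\<close> embeds \<open>\<real>[[t]]\<close> into \<open>\<real>[x][[t]]\<close>.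
\<close>

definition exp_x :: "real poly fps" where
  "exp_x = Abs_fps (\<lambda>n. monom (1 / fact n) n)"

definition fps_const_poly :: "real fps \<Rightarrow> real poly fps" where
  "fps_const_poly f = Abs_fps (\<lambda>n. [:fps_nth f n:])"

definition deg_rBell_gf :: "real \<Rightarrow> nat \<Rightarrow> real poly fps" where
  "deg_rBell_gf lam r =
     (exp_x oo (fps_const_poly (deg_exp lam 1) - 1)) * fps_const_poly (deg_exp lam (real r))"

definition deg_rBell_poly :: "real \<Rightarrow> nat \<Rightarrow> nat \<Rightarrow> real poly" where
  "deg_rBell_poly lam r n = smult (fact n) (fps_nth (deg_rBell_gf lam r) n)"

definition deg_rBell_number :: "real \<Rightarrow> nat \<Rightarrow> nat \<Rightarrow> real" where
  "deg_rBell_number lam r n = poly (deg_rBell_poly lam r n) 1"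

lemma deg_ffact_0 [simp]: "deg_ffact lam x 0 = 1"
  and deg_ffact_Suc: "deg_ffact lam x (Suc n) = deg_ffact lam x n * (x - real n * lam)"
  by (simp_all add: deg_ffact_def)

lemma ffact_of_nat_eq_0: "j < k \<Longrightarrow> ffact (real j) k = 0"
  by (auto simp: deg_ffact_def)

lemma ffact_of_nat_self: "ffact (real j) j \<noteq> 0"
  by (auto simp: deg_ffact_def)

lemma ffact_expansion_unique:
  assumes "\<And>x. (\<Sum>k\<le>n. c k * ffact x k) = (\<Sum>k\<le>n. d k * ffact x k)" and "j \<le> n"
  shows "c j = d j"
  using assms(2)
proof (induction j rule: less_induct)
  case (less j)
  have split: "(\<Sum>k\<le>n. a k * ffact (real j) k) =
      (\<Sum>k<j. a k * ffact (real j) k) + a j * ffact (real j) j" for a :: "nat \<Rightarrow> real"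
  proof -
    have "(\<Sum>k\<le>n. a k * ffact (real j) k) = (\<Sum>k\<le>j. a k * ffact (real j) k)"
      using less.prems by (intro sum.mono_neutral_right) (auto simp: ffact_of_nat_eq_0)
    then show ?thesis
      by (simp add: lessThan_Suc_atMost[symmetric])
  qed
  have "(\<Sum>k<j. c k * ffact (real j) k) = (\<Sum>k<j. d k * ffact (real j) k)"
    using less by (intro sum.cong) auto
  with assms(1)[of "real j"] have "c j * ffact (real j) j = d j * ffact (real j) j"
    unfolding split by simp
  then show ?case
    using ffact_of_nat_self[of j] by simp
qed

lemma ffact_expansion_exists:
  "\<exists>c. (\<forall>k>n. c k = 0) \<and>
     (\<forall>x. deg_ffact lam (x + real r) n = (\<Sum>k\<le>n. c k * ffact x k))"
proof (induction n)
  case 0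
  show ?case by (rule exI[of _ "\<lambda>k. if k = 0 then 1 else 0"]) auto
next
  case (Suc n)
  then obtain c where c0: "\<And>k. k > n \<Longrightarrow> c k = 0"
    and c: "\<And>x. deg_ffact lam (x + real r) n = (\<Sum>k\<le>n. c k * ffact x k)" by blast
  define d where "d k = (if k = 0 then 0 else c (k - 1)) + (real k + real r - real n * lam) * c k" for k
  have "deg_ffact lam (x + real r) (Suc n) = (\<Sum>k\<le>Suc n. d k * ffact x k)" for x
  proof -
    have "deg_ffact lam (x + real r) (Suc n) =
        (\<Sum>k\<le>n. c k * ffact x k) * (x + real r - real n * lam)"
      by (simp add: deg_ffact_Suc c)
    also have "\<dots> = (\<Sum>k\<le>n. c k * ffact x (Suc k)) +
        (\<Sum>k\<le>n. (real k + real r - real n * lam) * c k * ffact x k)"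
      unfolding sum_distrib_right sum.distrib[symmetric]
      by (intro sum.cong) (auto simp: deg_ffact_Suc algebra_simps)
    also have "(\<Sum>k\<le>n. c k * ffact x (Suc k)) =
        (\<Sum>k\<le>Suc n. (if k = 0 then 0 else c (k - 1)) * ffact x k)"
      by (subst sum.atMost_Suc_shift) simp
    also have "(\<Sum>k\<le>n. (real k + real r - real n * lam) * c k * ffact x k) =
        (\<Sum>k\<le>Suc n. (real k + real r - real n * lam) * c k * ffact x k)"
      by (simp add: c0)
    finally show ?thesis
      by (simp only: d_def sum.distrib[symmetric] distrib_right)
  qed
  moreover have "\<forall>k>Suc n. d k = 0"
    by (auto simp: d_def c0)
  ultimately show ?case by blast
qed

lemma deg_rStirling_ex1:
  "\<exists>!c. (\<forall>k>n. c k = 0) \<and>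
     (\<forall>x. deg_ffact lam (x + real r) n = (\<Sum>k\<le>n. c k * ffact x k))"
proof (rule ex_ex1I[OF ffact_expansion_exists])
  fix c d :: "nat \<Rightarrow> real"
  assume c: "(\<forall>k>n. c k = 0) \<and> (\<forall>x. deg_ffact lam (x + real r) n = (\<Sum>k\<le>n. c k * ffact x k))"
    and d: "(\<forall>k>n. d k = 0) \<and> (\<forall>x. deg_ffact lam (x + real r) n = (\<Sum>k\<le>n. d k * ffact x k))"
  show "c = d"
  proof
    fix j
    show "c j = d j"
    proof (cases "j \<le> n")
      case True
      have "(\<Sum>k\<le>n. c k * ffact x k) = (\<Sum>k\<le>n. d k * ffact x k)" for x
        using conjunct2[OF c, THEN spec, of x] conjunct2[OF d, THEN spec, of x] by (rule trans[OF sym])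
      then show ?thesis
        using True by (rule ffact_expansion_unique)
    next
      case False
      with conjunct1[OF c] conjunct1[OF d] show ?thesis by simp
    qed
  qed
qed

lemma deg_rStirling_eq_0: "k > n \<Longrightarrow> deg_rStirling lam r n k = 0"
  and deg_rStirling_expansion:
    "deg_ffact lam (x + real r) n = (\<Sum>k\<le>n. deg_rStirling lam r n k * ffact x k)"
  using theI'[OF deg_rStirling_ex1[of n lam r]] unfolding deg_rStirling_def by blast+

lemma fps_const_poly_mult: "fps_const_poly (f * g) = fps_const_poly f * fps_const_poly g"
proof -
  have const_sum: "[:sum h A:] = (\<Sum>i\<in>A. [:h i:])" for h :: "nat \<Rightarrow> real" and A
  proof (induction A rule: infinite_finite_induct)
    case (insert a A)
    have "[:sum h (insert a A):] = [:h a:] + [:sum h A:]"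
      using insert.hyps by simp
    then show ?case
      by (simp only: insert.IH sum.insert[OF insert.hyps])
  qed simp_all
  show ?thesis
    by (simp add: fps_eq_iff fps_const_poly_def fps_mult_nth const_sum mult.commute)
qed

lemma fps_const_poly_1: "fps_const_poly 1 = 1"
  by (simp add: fps_eq_iff fps_const_poly_def one_pCons)

lemma fps_const_poly_power: "fps_const_poly (f ^ n) = fps_const_poly f ^ n"
  by (induction n) (simp_all add: fps_const_poly_mult fps_const_poly_1)

lemma fps_const_poly_diff: "fps_const_poly (f - g) = fps_const_poly f - fps_const_poly g"
  by (simp add: fps_eq_iff fps_const_poly_def)

text \<open>The defining generating function, evaluated at a real \<open>x\<close>.\<close>

lemma deg_rBell_gf_eval:
  "(fps_exp x oo (deg_exp lam 1 - 1)) * deg_exp lam (real r) =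
     Abs_fps (\<lambda>n. poly (deg_rBell_poly lam r n) x / fact n)"
proof (rule fps_ext)
  fix n
  have comp: "poly (fps_nth (exp_x oo (fps_const_poly (deg_exp lam 1) - 1)) i) x =
      fps_nth (fps_exp x oo (deg_exp lam 1 - 1)) i" for i
  proof -
    have "fps_const_poly (deg_exp lam 1) - 1 = fps_const_poly (deg_exp lam 1 - 1)"
      by (simp only: fps_const_poly_diff fps_const_poly_1)
    then have "poly (fps_nth (exp_x oo (fps_const_poly (deg_exp lam 1) - 1)) i) x =
        (\<Sum>j=0..i. poly (monom (1 / fact j) j * [:fps_nth ((deg_exp lam 1 - 1) ^ j) i:]) x)"
      by (simp only: fps_compose_nth fps_const_poly_power[symmetric] poly_sum)
         (simp only: fps_const_poly_def exp_x_def fps_nth_Abs_fps)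
    also have "\<dots> = fps_nth (fps_exp x oo (deg_exp lam 1 - 1)) i"
      unfolding fps_compose_nth by (intro sum.cong refl) (simp add: poly_monom)
    finally show ?thesis .
  qed
  show "fps_nth ((fps_exp x oo (deg_exp lam 1 - 1)) * deg_exp lam (real r)) n =
      fps_nth (Abs_fps (\<lambda>n. poly (deg_rBell_poly lam r n) x / fact n)) n"
    by (simp add: deg_rBell_poly_def deg_rBell_gf_def fps_mult_nth poly_sum comp)
       (simp add: fps_const_poly_def mult.commute)
qed

end

theory Submission
  imports Defs
begin

text \<open>
  Let \<open>F\<close> be the generating function at a real \<open>x\<close> and write \<open>E\<^sub>a\<close> for the degenerate exponential
  with exponent \<open>a\<close>. Since \<open>E\<^sub>a' = a E\<^bsub>a - \<lambda>\<^esub>\<close>, one has \<open>F' = (x E\<^bsub>1 - \<lambda>\<^esub> + r E\<^bsub>-\<lambda>\<^esub>) F\<close>, and the triangular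
  recurrence of the \<open>r\<close>-Stirling numbers \<open>S(m, k)\<close> is exactly what makes the \<open>m\<close>-th derivative of \<open>F\<close>
  equal to \<open>(\<Sum>k. S(m, k) x\<^sup>k E\<^bsub>k - m\<lambda>\<^esub>) F\<close>. Compare coefficients of \<open>t\<^sup>n / n!\<close>.
\<close>

lemma deg_ffact_Suc_left: "deg_ffact lam a (Suc n) = a * deg_ffact lam (a - lam) n"
  by (simp add: deg_ffact_def prod.lessThan_Suc_shift algebra_simps del: prod.lessThan_Suc)

text \<open>The series is \<open>(1 + lam t)\<close> raised to the power \<open>a / lam\<close>.
  This reduces the exponent law below to the one for binomial series.\<close>

lemma deg_exp_eq_fps_binomial:
  assumes "lam \<noteq> 0"
  shows "deg_exp lam a = fps_binomial (a / lam) oo (fps_const lam * fps_X)"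
proof (rule fps_ext)
  fix n
  have "deg_ffact lam a n = (\<Prod>i<n. lam * (a / lam - real i))"
    unfolding deg_ffact_def using assms by (intro prod.cong refl) (simp add: field_simps)
  then have "deg_ffact lam a n = lam ^ n * (\<Prod>i<n. a / lam - real i)"
    by (simp add: prod.distrib)
  then show "fps_nth (deg_exp lam a) n =
      fps_nth (fps_binomial (a / lam) oo (fps_const lam * fps_X)) n"
    by (simp add: deg_exp_def fps_compose_linear gbinomial_prod_rev atLeast0LessThan)
qed

lemma deg_exp_add:
  assumes "lam \<noteq> 0"
  shows "deg_exp lam (a + b) = deg_exp lam a * deg_exp lam b"
  using assms
  by (simp add: deg_exp_eq_fps_binomial add_divide_distrib fps_binomial_add_mult
      fps_compose_mult_distrib)

lemma fps_deriv_deg_exp: "fps_deriv (deg_exp lam a) = fps_const a * deg_exp lam (a - lam)"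
  by (rule fps_ext) (simp add: deg_exp_def deg_ffact_Suc_left del: of_nat_Suc)

text \<open>Fixing a real \<open>x\<close> keeps the calculus in power series over a field;
  \<open>deg_rBell_gf_eval\<close> gives the coefficients.\<close>

definition deg_rBell_egf :: "real \<Rightarrow> nat \<Rightarrow> real \<Rightarrow> real fps" where
  "deg_rBell_egf lam r x = (fps_exp x oo (deg_exp lam 1 - 1)) * deg_exp lam (real r)"

lemma fps_deriv_deg_rBell_egf:
  assumes "lam \<noteq> 0"
  shows "fps_deriv (deg_rBell_egf lam r x) =
    (fps_const x * deg_exp lam (1 - lam) + fps_const (real r) * deg_exp lam (- lam)) *
      deg_rBell_egf lam r x"
proof -
  \<comment> \<open>A zero constant term is what the chain rule for composition requires.\<close>
  have "fps_nth (deg_exp lam 1 - 1) 0 = 0"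
    by (simp add: deg_exp_def)
  moreover have "deg_exp lam (real r - lam) = deg_exp lam (- lam) * deg_exp lam (real r)"
    using deg_exp_add[OF assms, of "- lam" "real r"] by simp
  ultimately show ?thesis
    by (simp add: deg_rBell_egf_def fps_compose_deriv fps_deriv_deg_exp fps_compose_mult_distrib
        algebra_simps)
qed

lemma deg_rStirling_0: "deg_rStirling lam r 0 0 = 1"
  using deg_rStirling_expansion[of lam 0 r 0] by simp

text \<open>The new factor \<open>x + r - n lam\<close> splits as
  \<open>(x - k) + (k + r - n lam)\<close>: on \<open>ffact x k\<close> the first part raises
  \<open>k\<close> by one, the second only scales. Uniqueness of the expansion then identifies the
  coefficients.\<close>

lemma deg_rStirling_Suc:
  "deg_rStirling lam r (Suc n) k =
     (if k = 0 then 0 else deg_rStirling lam r n (k - 1)) +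
     (real k + real r - real n * lam) * deg_rStirling lam r n k"
proof -
  let ?S = "deg_rStirling lam r n"
  define d where "d k = (if k = 0 then 0 else ?S (k - 1)) + (real k + real r - real n * lam) * ?S k" for k
  have "deg_ffact lam (x + real r) (Suc n) = (\<Sum>k\<le>Suc n. d k * ffact x k)" for x
  proof -
    have "deg_ffact lam (x + real r) (Suc n) =
        (\<Sum>k\<le>n. ?S k * ffact x k) * (x + real r - real n * lam)"
      by (simp add: deg_ffact_Suc deg_rStirling_expansion)
    also have "\<dots> = (\<Sum>k\<le>n. ?S k * ffact x (Suc k)) +
        (\<Sum>k\<le>n. (real k + real r - real n * lam) * ?S k * ffact x k)"
      unfolding sum_distrib_right sum.distrib[symmetric]
      by (intro sum.cong) (auto simp: deg_ffact_Suc algebra_simps)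
    also have "(\<Sum>k\<le>n. ?S k * ffact x (Suc k)) =
        (\<Sum>k\<le>Suc n. (if k = 0 then 0 else ?S (k - 1)) * ffact x k)"
      by (subst sum.atMost_Suc_shift) simp
    also have "(\<Sum>k\<le>n. (real k + real r - real n * lam) * ?S k * ffact x k) =
        (\<Sum>k\<le>Suc n. (real k + real r - real n * lam) * ?S k * ffact x k)"
      by (simp add: deg_rStirling_eq_0)
    finally show ?thesis
      by (simp only: d_def sum.distrib[symmetric] distrib_right)
  qed
  moreover have "\<forall>k>Suc n. d k = 0"
    by (auto simp: d_def deg_rStirling_eq_0)
  ultimately have "deg_rStirling lam r (Suc n) = d"
    unfolding deg_rStirling_def by (intro the1_equality[OF deg_rStirling_ex1]) blast
  then show ?thesis by (simp add: d_def)
qed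

lemma higher_deriv_deg_rBell_egf:
  assumes "lam \<noteq> 0"
  shows "(fps_deriv ^^ m) (deg_rBell_egf lam r x) =
    (\<Sum>k\<le>m. fps_const (deg_rStirling lam r m k * x ^ k) * deg_exp lam (real k - real m * lam)) *
      deg_rBell_egf lam r x"
proof (induction m)
  case 0
  have "deg_exp lam 0 = 1"
    by (rule fps_ext) (auto simp: deg_exp_def deg_ffact_def)
  then show ?case by (simp add: deg_rStirling_0)
next
  case (Suc m)
  let ?S = "deg_rStirling lam r m" and ?F = "deg_rBell_egf lam r x"
  let ?E = "\<lambda>k. deg_exp lam (real k - real (Suc m) * lam)"
  \<comment> \<open>The contributions \<open>k - m lam\<close> (from the exponential) and
    \<open>r\<close> (from \<open>?F\<close>) share the factor \<open>?E k\<close>, and together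
    they form the weight in \<open>deg_rStirling_Suc\<close>.\<close>
  have step: "fps_deriv (deg_exp lam (real k - real m * lam) * ?F) =
      (fps_const (real k + real r - real m * lam) * ?E k + fps_const x * ?E (Suc k)) * ?F" for k
  proof -
    let ?a = "real k - real m * lam"
    have "deg_exp lam ?a * deg_exp lam (- lam) = ?E k"
      "deg_exp lam ?a * deg_exp lam (1 - lam) = ?E (Suc k)"
      "deg_exp lam (?a - lam) = ?E k"
      by (simp_all add: deg_exp_add[OF assms, symmetric] algebra_simps)
    moreover have "fps_const (real k + real r - real m * lam) =
        fps_const ?a + fps_const (real r)"
      by simp
    moreover have "fps_deriv (deg_exp lam ?a * ?F) =
        fps_const x * (deg_exp lam ?a * deg_exp lam (1 - lam)) * ?F +
        fps_const (real r) * (deg_exp lam ?a * deg_exp lam (- lam)) * ?F +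
        fps_const ?a * deg_exp lam (?a - lam) * ?F"
      unfolding fps_deriv_mult fps_deriv_deg_exp fps_deriv_deg_rBell_egf[OF assms]
      by (simp only: algebra_simps)
    ultimately show ?thesis
      by (simp only: algebra_simps)
  qed
  have "(fps_deriv ^^ Suc m) ?F =
      (\<Sum>k\<le>m. fps_const (?S k * x ^ k) * fps_deriv (deg_exp lam (real k - real m * lam) * ?F))"
    by (simp add: Suc.IH sum_distrib_right fps_deriv_sum mult.assoc del: fps_deriv_mult)
  also have "\<dots> = ((\<Sum>k\<le>m. fps_const (?S k * x ^ Suc k) * ?E (Suc k)) +
      (\<Sum>k\<le>m. fps_const ((real k + real r - real m * lam) * ?S k * x ^ k) * ?E k)) * ?F"
    unfolding step sum.distrib[symmetric] sum_distrib_right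
    by (intro sum.cong refl, simp only: fps_const_mult[symmetric] power_Suc)
      (simp only: algebra_simps)
  also have "(\<Sum>k\<le>m. fps_const (?S k * x ^ Suc k) * ?E (Suc k)) =
      (\<Sum>k\<le>Suc m. fps_const ((if k = 0 then 0 else ?S (k - 1)) * x ^ k) * ?E k)"
    by (subst sum.atMost_Suc_shift) simp
  \<comment> \<open>The added term vanishes because \<open>?S (Suc m) = 0\<close>; both sums now
    have the same range.\<close>
  also have "(\<Sum>k\<le>m. fps_const ((real k + real r - real m * lam) * ?S k * x ^ k) * ?E k) =
      (\<Sum>k\<le>Suc m. fps_const ((real k + real r - real m * lam) * ?S k * x ^ k) * ?E k)"
    by (simp add: deg_rStirling_eq_0)
  finally show ?case
    by (simp only: deg_rStirling_Suc sum.distrib[symmetric] distrib_right fps_const_add[symmetric])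
qed

lemma higher_deriv_egf:
  fixes a :: "nat \<Rightarrow> 'a::field_char_0"
  shows "(fps_deriv ^^ m) (Abs_fps (\<lambda>n. a n / fact n)) = Abs_fps (\<lambda>n. a (n + m) / fact n)"
  by (induction m) (auto simp: fps_eq_iff simp del: of_nat_Suc)

lemma poly_deg_rBell_poly_add:
  assumes "lam \<noteq> 0"
  shows "poly (deg_rBell_poly lam r (n + m)) x =
    (\<Sum>k=0..m. \<Sum>l=0..n. real (n choose l) * deg_rStirling lam r m k *
       deg_ffact lam (real k - real m * lam) (n - l) * (x ^ k * poly (deg_rBell_poly lam r l) x))"
proof -
  let ?\<phi> = "\<lambda>l. poly (deg_rBell_poly lam r l) x"
  have egf: "deg_rBell_egf lam r x = Abs_fps (\<lambda>n. ?\<phi> n / fact n)"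
    by (simp add: deg_rBell_egf_def deg_rBell_gf_eval)
  have "?\<phi> (n + m) = fact n * fps_nth ((fps_deriv ^^ m) (deg_rBell_egf lam r x)) n"
    by (simp add: egf higher_deriv_egf)
  also have "\<dots> = (\<Sum>k\<le>m. \<Sum>l=0..n. fact n * (deg_rStirling lam r m k * x ^ k *
      (?\<phi> l / fact l * (deg_ffact lam (real k - real m * lam) (n - l) / fact (n - l)))))"
    \<comment> \<open>Commuting puts the Bell series first, so that the Cauchy product index
      \<open>l\<close> falls on it and \<open>n - l\<close> on the exponential.\<close>
    unfolding higher_deriv_deg_rBell_egf[OF assms] sum_distrib_right
      mult.assoc mult.commute[of "deg_exp _ _"]
    by (simp add: egf fps_sum_nth sum_distrib_left fps_mult_nth[of "Abs_fps _"] deg_exp_def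
        mult.assoc)
  also have "\<dots> = (\<Sum>k=0..m. \<Sum>l=0..n. real (n choose l) * deg_rStirling lam r m k *
       deg_ffact lam (real k - real m * lam) (n - l) * (x ^ k * ?\<phi> l))"
    unfolding atMost_atLeast0
    by (intro sum.cong refl) (simp add: binomial_fact field_simps)
  finally show ?thesis .
qed

theorem theorem2p4:
  fixes lam :: real and r n m :: nat
  assumes "lam \<noteq> 0"
  shows "deg_rBell_poly lam r (n + m) =
           (\<Sum>k=0..m. \<Sum>l=0..n.
              smult (real (n choose l) * deg_rStirling lam r m k
                       * deg_ffact lam (real k - real m * lam) (n - l))
                (monom 1 k * deg_rBell_poly lam r l))
    \<and> deg_rBell_number lam r (n + m) =
           (\<Sum>k=0..m. \<Sum>l=0..n.
              real (n choose l) * deg_rStirling lam r m k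
                * deg_ffact lam (real k - real m * lam) (n - l)
                * deg_rBell_number lam r l)"
proof
  show "deg_rBell_poly lam r (n + m) =
      (\<Sum>k=0..m. \<Sum>l=0..n.
         smult (real (n choose l) * deg_rStirling lam r m k
                  * deg_ffact lam (real k - real m * lam) (n - l))
           (monom 1 k * deg_rBell_poly lam r l))"
    \<comment> \<open>Real polynomials that agree at every real \<open>x\<close> are equal, so the
      pointwise identity suffices.\<close>
    by (subst poly_eq_poly_eq_iff[symmetric], rule ext)
      (simp add: poly_deg_rBell_poly_add[OF assms] poly_sum poly_monom)
qed (simp add: deg_rBell_number_def poly_deg_rBell_poly_add[OF assms])

end
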